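(* Let $X$ be a non-compact simply connected harmonic manifold of rank one. Let $p,q,r>0$ satisfy $1+\frac1r=\frac1p+\frac1q$. Then for $f\in L^p(X)$ and $g\in L^q(X)$, with $g=u\circ d_\sigma$ radial around $\sigma\in X$, we have $f*g\in L^r(X)$ and $$\|f*g\|_r\le\|f\|_p\cdot\|g\|_q.$$
   Context: $(X,g)$ is an $n$-dimensional non-compact simply connected harmonic manifold: in geodesic polar coordinates about any point the volume density is a function $A(r)$ of the geodesic distance only, so for every $x\in X$ and $u\ge0$ measurable $\int_Xu(d(x,y))\,dy=\omega_{n-1}\int_0^\infty u(r)A(r)\,dr$, with $\omega_{n-1}$ the volume of the unit sphere $S^{n-1}\subset\mathbb{R}^n$. "Rank one" is equivalent to purely exponential volume growth: there are $C\ge1$ and $\rho>0$ with $\frac1C\le A(r)e^{-2\rho r}\le C$ for $r\ge1$. $d_\sigma=d(\sigma,\cdot)$ is the distance function from $\sigma$. For $g=u\circ d_\sigma$ radial around $\sigma$, its $x$-translate is $\tau_xg=u\circ d_x$, and the convolution of a function $f$ with $g$ is $(f*g)(x)=\int_Xf(y)\,\tau_xg(y)\,dy$.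
   Formalization: The formal theorem assumes p, q ≥ 1 instead of p, q > 0: for p < 1 (and likewise q < 1) the inequality fails on every such X, e.g. f = ε^{-n/p}·1_{B(σ,ε)}, g = 1_{B(σ,1)} as ε → 0. *)

theory Defs
  imports "HOL-Analysis.Analysis"
begin

section \<open>Smooth manifolds\<close>

text \<open>\<open>C\<^sup>k\<close> regularity; only used on open sets \<open>S\<close>, where the derivatives
  \<open>at x\<close> and \<open>at x within S\<close> agree.\<close>

fun Ck_on :: "nat \<Rightarrow> ('e::real_normed_vector \<Rightarrow> 'f::real_normed_vector) \<Rightarrow> 'e set \<Rightarrow> bool" where
  "Ck_on 0 f S \<longleftrightarrow> continuous_on S f"
| "Ck_on (Suc k) f S \<longleftrightarrow> f differentiable_on S \<and>
     (\<forall>v. Ck_on k (\<lambda>x. frechet_derivative f (at x) v) S)"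

definition smooth_on :: "('e::real_normed_vector \<Rightarrow> 'f::real_normed_vector) \<Rightarrow> 'e set \<Rightarrow> bool" where
  "smooth_on f S \<longleftrightarrow> (\<forall>k. Ck_on k f S)"

text \<open>A chart is a pair \<open>(U, \<phi>)\<close>; the values of \<open>\<phi>\<close> outside \<open>U\<close> are irrelevant.\<close>

definition param :: "'a set \<times> ('a \<Rightarrow> real^'n) \<Rightarrow> real^'n \<Rightarrow> 'a" where
  "param c = inv_into (fst c) (snd c)"

definition is_chart :: "'a::topological_space set \<times> ('a \<Rightarrow> real^'n) \<Rightarrow> bool" where
  "is_chart c \<longleftrightarrow> open (fst c) \<and> open (snd c ` fst c) \<and>
     homeomorphism (fst c) (snd c ` fst c) (snd c) (param c)"

definition transition ::
  "'a set \<times> ('a \<Rightarrow> real^'n) \<Rightarrow> 'a set \<times> ('a \<Rightarrow> real^'n) \<Rightarrow> real^'n \<Rightarrow> real^'n" where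
  "transition c c' = snd c' \<circ> param c"

definition smooth_transition ::
  "'a set \<times> ('a \<Rightarrow> real^'n) \<Rightarrow> 'a set \<times> ('a \<Rightarrow> real^'n) \<Rightarrow> bool" where
  "smooth_transition c c' \<longleftrightarrow> smooth_on (transition c c') (snd c ` (fst c \<inter> fst c'))"

text \<open>The manifold is the whole type \<open>'a\<close>, its dimension is \<open>CARD('n)\<close>, and the atlas is maximal.\<close>

locale smooth_manifold =
  fixes atlas :: "('a::{t2_space,second_countable_topology} set \<times> ('a \<Rightarrow> real^'n)) set"
  assumes charts: "c \<in> atlas \<Longrightarrow> is_chart c"
    and cover: "(\<Union>c\<in>atlas. fst c) = UNIV"
    and smooth_transitions: "c \<in> atlas \<Longrightarrow> c' \<in> atlas \<Longrightarrow> smooth_transition c c'"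
    and maximal: "is_chart c \<Longrightarrow> (\<And>c'. c' \<in> atlas \<Longrightarrow> smooth_transition c c' \<and> smooth_transition c' c)
      \<Longrightarrow> c \<in> atlas"


section \<open>Riemannian manifolds\<close>

text \<open>A Riemannian metric is given by its Gram matrices: \<open>G c x\<close> is the matrix of the inner product
  on the tangent space at \<open>x\<close> in the coordinate basis of the chart \<open>c\<close>.\<close>

definition piecewise_C1_curve ::
  "('a::topological_space set \<times> ('a \<Rightarrow> real^'n)) set \<Rightarrow> (real \<Rightarrow> 'a) \<Rightarrow> bool" where
  "piecewise_C1_curve atlas \<gamma> \<longleftrightarrow> path \<gamma> \<and>
     (\<exists>S. finite S \<and>
       (\<forall>c\<in>atlas. (snd c \<circ> \<gamma>) C1_differentiable_on {t \<in> {0<..<1} - S. \<gamma> t \<in> fst c}))"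

text \<open>The chosen chart does not matter, by the transformation rule for Gram matrices.\<close>

definition speed ::
  "('a set \<times> ('a \<Rightarrow> real^'n)) set \<Rightarrow> ('a set \<times> ('a \<Rightarrow> real^'n) \<Rightarrow> 'a \<Rightarrow> real^'n^'n)
     \<Rightarrow> (real \<Rightarrow> 'a) \<Rightarrow> real \<Rightarrow> real" where
  "speed atlas G \<gamma> t =
    (let c = (SOME c. c \<in> atlas \<and> \<gamma> t \<in> fst c);
         v = vector_derivative (snd c \<circ> \<gamma>) (at t)
     in sqrt (v \<bullet> (G c (\<gamma> t) *v v)))"

definition curve_length ::
  "('a set \<times> ('a \<Rightarrow> real^'n)) set \<Rightarrow> ('a set \<times> ('a \<Rightarrow> real^'n) \<Rightarrow> 'a \<Rightarrow> real^'n^'n)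
     \<Rightarrow> (real \<Rightarrow> 'a) \<Rightarrow> ennreal" where
  "curve_length atlas G \<gamma> = (\<integral>\<^sup>+t\<in>{0..1}. ennreal (speed atlas G \<gamma> t) \<partial>lborel)"

text \<open>The last axiom identifies the metric of the type \<open>'a\<close> with the geodesic distance; since
  the infimum of the empty set is \<open>\<infinity>\<close>, it includes connectedness.\<close>

locale riemannian_manifold =
  smooth_manifold atlas
  for atlas :: "('a::{metric_space,second_countable_topology} set \<times> ('a \<Rightarrow> real^'n)) set" +
  fixes G :: "'a set \<times> ('a \<Rightarrow> real^'n) \<Rightarrow> 'a \<Rightarrow> real^'n^'n"
  assumes G_sym: "c \<in> atlas \<Longrightarrow> x \<in> fst c \<Longrightarrow> transpose (G c x) = G c x"
    and G_pos: "c \<in> atlas \<Longrightarrow> x \<in> fst c \<Longrightarrow> v \<noteq> 0 \<Longrightarrow> v \<bullet> (G c x *v v) > 0"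
    and G_smooth: "c \<in> atlas \<Longrightarrow> smooth_on (\<lambda>z. G c (param c z)) (snd c ` fst c)"
    and G_transform: "c \<in> atlas \<Longrightarrow> c' \<in> atlas \<Longrightarrow> x \<in> fst c \<inter> fst c' \<Longrightarrow>
      J = matrix (frechet_derivative (transition c c') (at (snd c x))) \<Longrightarrow>
      G c x = transpose J ** G c' x ** J"
    and geodesic_distance: "ennreal (dist x y) =
      (INF \<gamma>\<in>{\<gamma>. piecewise_C1_curve atlas \<gamma> \<and> pathstart \<gamma> = x \<and> pathfinish \<gamma> = y}.
         curve_length atlas G \<gamma>)"
begin

definition is_volume :: "'a measure \<Rightarrow> bool" where
  "is_volume vol \<longleftrightarrow> sets vol = sets borel \<and>
     (\<forall>c\<in>atlas. \<forall>B\<in>sets borel. B \<subseteq> fst c \<longrightarrow>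
        emeasure vol B = (\<integral>\<^sup>+z\<in>snd c ` B. ennreal (sqrt (det (G c (param c z)))) \<partial>lborel))"

text \<open>\<open>christoffel c z k i j\<close> is \<open>\<Gamma>\<^sup>k\<^sub>i\<^sub>j\<close> at the point with coordinates \<open>z\<close>; here
  \<open>D i j l\<close> stands for the partial derivative \<open>\<partial>\<^sub>i g\<^sub>j\<^sub>l\<close>.\<close>

definition christoffel :: "'a set \<times> ('a \<Rightarrow> real^'n) \<Rightarrow> real^'n \<Rightarrow> 'n \<Rightarrow> 'n \<Rightarrow> 'n \<Rightarrow> real" where
  "christoffel c z k i j =
    (let D = (\<lambda>i j l. frechet_derivative (\<lambda>z. G c (param c z) $ j $ l) (at z) (axis i 1))
     in (1/2) * (\<Sum>l\<in>UNIV. matrix_inv (G c (param c z)) $ k $ l * (D i j l + D j i l - D l i j)))"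

definition geodesic :: "(real \<Rightarrow> 'a) \<Rightarrow> bool" where
  "geodesic \<gamma> \<longleftrightarrow> continuous_on UNIV \<gamma> \<and>
     (\<forall>c\<in>atlas. \<forall>t. \<gamma> t \<in> fst c \<longrightarrow>
       (let \<kappa> = snd c \<circ> \<gamma>; \<kappa>' = (\<lambda>s. vector_derivative \<kappa> (at s)) in
         \<kappa> differentiable (at t) \<and>
         (\<kappa>' has_vector_derivative
            (\<chi> k. - (\<Sum>i\<in>UNIV. \<Sum>j\<in>UNIV. christoffel c (\<kappa> t) k i j * \<kappa>' t $ i * \<kappa>' t $ j))) (at t)))"

text \<open>\<open>c\<close> is the global chart \<open>exp\<^sub>x\<^sup>-\<^sup>1\<close>, with the tangent space at \<open>x\<close> identified with
  \<open>\<real>\<^sup>n\<close> by an orthonormal basis. The geodesic polar coordinates of \<open>y\<close> are the radius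
  \<open>norm (snd c y)\<close>, which is the geodesic distance from \<open>x\<close>, and the direction of \<open>snd c y\<close>.\<close>

definition geodesic_coordinates :: "'a \<Rightarrow> 'a set \<times> ('a \<Rightarrow> real^'n) \<Rightarrow> bool" where
  "geodesic_coordinates x c \<longleftrightarrow>
     c \<in> atlas \<and> fst c = UNIV \<and> range (snd c) = UNIV \<and>
     snd c x = 0 \<and> G c x = mat 1 \<and>
     (\<forall>v. geodesic (\<lambda>t. param c (t *\<^sub>R v))) \<and>
     (\<forall>y. dist x y = norm (snd c y))"

end


section \<open>Harmonic manifolds\<close>

text \<open>Simply connected non-compact harmonic manifolds have no conjugate points, so that geodesic
  polar coordinates about every point are defined on the whole manifold; in particular it is complete. The volume element is \<open>\<surd>(det g) dz = \<surd>(det g) s\<^sup>n\<^sup>-\<^sup>1 ds d\<theta>\<close> in these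
  coordinates, where \<open>s = norm z\<close>, whence the density in the last axiom.\<close>

locale harmonic_manifold =
  riemannian_manifold atlas G
  for atlas :: "('a::{metric_space,second_countable_topology} set \<times> ('a \<Rightarrow> real^'n)) set"
    and G :: "'a set \<times> ('a \<Rightarrow> real^'n) \<Rightarrow> 'a \<Rightarrow> real^'n^'n" +
  fixes vol :: "'a measure" and A :: "real \<Rightarrow> real"
  assumes volume: "is_volume vol"
    and geodesic_coordinates_exist: "\<exists>c. geodesic_coordinates x c"
    and radial_density: "geodesic_coordinates x c \<Longrightarrow> y \<noteq> x \<Longrightarrow>
      sqrt (det (G c y)) * norm (snd c y) ^ (CARD('n) - 1) = A (dist x y)"

text \<open>For non-compact simply connected harmonic manifolds, rank one is equivalent to purely exponential
  volume growth, which is a condition on the density \<open>A\<close>.\<close>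

definition rank_one :: "(real \<Rightarrow> real) \<Rightarrow> bool" where
  "rank_one A \<longleftrightarrow> (\<exists>C\<ge>1. \<exists>\<rho>>0. \<forall>s\<ge>1. 1 / C \<le> A s * exp (- 2 * \<rho> * s) \<and> A s * exp (- 2 * \<rho> * s) \<le> C)"


section \<open>Lebesgue spaces and convolution\<close>

definition Lp_space :: "real \<Rightarrow> 'a measure \<Rightarrow> ('a \<Rightarrow> complex) set" where
  "Lp_space p M = {f \<in> borel_measurable M. integrable M (\<lambda>x. norm (f x) powr p)}"

definition Lp_norm :: "real \<Rightarrow> 'a measure \<Rightarrow> ('a \<Rightarrow> complex) \<Rightarrow> real" where
  "Lp_norm p M f = (LINT x|M. norm (f x) powr p) powr (1 / p)"

text \<open>A radial function enters these two operations through its profile \<open>u\<close>.\<close>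

definition translate :: "(real \<Rightarrow> complex) \<Rightarrow> 'a::metric_space \<Rightarrow> 'a \<Rightarrow> complex" where
  "translate u x = u \<circ> dist x"

definition convolution ::
  "'a::metric_space measure \<Rightarrow> ('a \<Rightarrow> complex) \<Rightarrow> (real \<Rightarrow> complex) \<Rightarrow> 'a \<Rightarrow> complex" where
  "convolution vol f u x = (LINT y|vol. f y * translate u x y)"

end

theory Submission
  imports Defs
begin

text \<open>
  Young's inequality holds with constant one for every integral operator whose kernel \<open>k\<close>
  satisfies the same bound \<open>\<integral>|k|\<^sup>q \<le> B\<^sup>q\<close> along all rows and all columns: writing
  \<open>|f k| = (|f|\<^sup>p|k|\<^sup>q)\<^bsup>1/r\<^esup> \<cdot> (|f|\<^sup>p)\<^bsup>1-1/q\<^esup> \<cdot> (|k|\<^sup>q)\<^bsup>1-1/p\<^esup>\<close>, Hoelder's inequality for three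
  functions bounds the operator pointwise by the \<open>r\<close>-th root of \<open>\<integral>|f|\<^sup>p|k|\<^sup>q\<close>, and the integral of that
  quantity splits by Tonelli's theorem (\<open>Young_integral_operator\<close>).

  Convolution with a radial function is such an operator, with kernel \<open>k(x,y) = u(d(x,y))\<close>. The kernel
  is symmetric, so rows and columns have the same integrals, and it remains to see that
  \<open>\<integral>|u(d(x,y))|\<^sup>q dy\<close> does not depend on \<open>x\<close>. This is where harmonicity enters
  (\<open>nn_integral_radial\<close>): in geodesic coordinates \<open>z\<close> about \<open>x\<close> the distance is \<open>|z|\<close> and the volume
  density is \<open>A(|z|)/|z|\<^bsup>n-1\<^esup>\<close>, so the integral becomes one over \<open>\<real>\<^sup>n\<close> in which \<open>x\<close> no longer appears.
  Its value is therefore the one at \<open>x = \<sigma>\<close>, which is the \<open>q\<close>-th power of the norm of \<open>g\<close>.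

  Measurability of the kernel needs the profile \<open>u\<close> to be measurable on the half-line, while only
  \<open>g\<close> is given to be; \<open>u\<close> is recovered by restricting \<open>g\<close> to a geodesic ray from \<open>\<sigma>\<close>
  (\<open>radial_profile_measurable\<close>).
\<close>

section \<open>Hoelder's inequality for three functions\<close>

text \<open>With \<open>m\<close> the weighted arithmetic mean, the claim is Jensen's inequality for the concave
  logarithm, obtained by averaging its tangent line at \<open>m\<close>. If a factor vanishes the left side is zero
  even when its exponent is zero, since \<open>0 powr 0 = 0\<close>.\<close>

lemma weighted_arith_geo_mean3:
  fixes x y z a b c :: real
  assumes "x \<ge> 0" "y \<ge> 0" "z \<ge> 0" and w: "a \<ge> 0" "b \<ge> 0" "c \<ge> 0" "a + b + c = 1"
  shows "x powr a * y powr b * z powr c \<le> a * x + b * y + c * z"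
proof (cases "x = 0 \<or> y = 0 \<or> z = 0")
  case True
  then have "x powr a * y powr b * z powr c = 0"
    by auto
  moreover have "a * x + b * y + c * z \<ge> 0"
    using assms by simp
  ultimately show ?thesis
    by linarith
next
  case False
  with assms have pos: "x > 0" "y > 0" "z > 0"
    by auto
  define m where "m = a * x + b * y + c * z"
  have "m > 0"
  proof -
    from w have "a > 0 \<or> b > 0 \<or> c > 0"
      by linarith
    with pos have "a * x > 0 \<or> b * y > 0 \<or> c * z > 0"
      by auto
    moreover have "a * x \<ge> 0" "b * y \<ge> 0" "c * z \<ge> 0"
      using pos w by auto
    ultimately show ?thesis
      unfolding m_def by linarith
  qed
  have tangent: "t * ln s \<le> t * (ln m + s / m - 1)" if "t \<ge> 0" "s > 0" for s t
    using ln_le_minus_one[of "s / m"] that \<open>m > 0\<close>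
    by (intro mult_left_mono) (auto simp: ln_div)
  have "a * ln x + b * ln y + c * ln z
      \<le> a * (ln m + x / m - 1) + b * (ln m + y / m - 1) + c * (ln m + z / m - 1)"
    using pos w by (intro add_mono tangent) auto
  also have "\<dots> = (a + b + c) * (ln m - 1) + (a * x + b * y + c * z) / m"
    using \<open>m > 0\<close> by (simp add: field_simps)
  also have "\<dots> = ln m"
    using w(4) \<open>m > 0\<close> by (simp add: m_def)
  finally have "exp (a * ln x + b * ln y + c * ln z) \<le> exp (ln m)"
    by simp
  then show ?thesis
    using pos \<open>m > 0\<close> by (simp add: powr_def exp_add m_def)
qed

text \<open>After normalizing the bounds to one, this is the integrated inequality of the means. Zero exponents
  are allowed and need no separate treatment: when one of the bounds is zero, one of the functions vanishes
  almost everywhere, and with the convention \<open>0 powr 0 = 0\<close> so does the product. This covers the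
  endpoints \<open>p = 1\<close> and \<open>q = 1\<close> of Young's inequality.\<close>

lemma Holder3_nn_integral:
  fixes F G H :: "'a \<Rightarrow> real"
  assumes [measurable]: "F \<in> borel_measurable M" "G \<in> borel_measurable M" "H \<in> borel_measurable M"
    and nonneg: "\<And>x. F x \<ge> 0" "\<And>x. G x \<ge> 0" "\<And>x. H x \<ge> 0"
    and bounds: "(\<integral>\<^sup>+x. ennreal (F x) \<partial>M) \<le> ennreal I" "(\<integral>\<^sup>+x. ennreal (G x) \<partial>M) \<le> ennreal J"
      "(\<integral>\<^sup>+x. ennreal (H x) \<partial>M) \<le> ennreal K"
    and IJK: "I \<ge> 0" "J \<ge> 0" "K \<ge> 0"
    and w: "a \<ge> 0" "b \<ge> 0" "c \<ge> 0" "a + b + c = 1"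
  shows "(\<integral>\<^sup>+x. ennreal (F x powr a * G x powr b * H x powr c) \<partial>M)
    \<le> ennreal (I powr a * J powr b * K powr c)"
proof (cases "I = 0 \<or> J = 0 \<or> K = 0")
  case True
  then have "(\<integral>\<^sup>+x. ennreal (F x) \<partial>M) = 0 \<or> (\<integral>\<^sup>+x. ennreal (G x) \<partial>M) = 0
      \<or> (\<integral>\<^sup>+x. ennreal (H x) \<partial>M) = 0"
    using bounds by auto
  then have "(AE x in M. F x = 0) \<or> (AE x in M. G x = 0) \<or> (AE x in M. H x = 0)"
    using nonneg by (simp add: nn_integral_0_iff_AE ennreal_eq_0_iff antisym_conv)
  then have "AE x in M. F x powr a * G x powr b * H x powr c = 0"
    by (elim disjE) (auto elim!: eventually_mono)
  then have "(\<integral>\<^sup>+x. ennreal (F x powr a * G x powr b * H x powr c) \<partial>M) = 0"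
    by (subst nn_integral_0_iff_AE) (auto elim!: eventually_mono)
  then show ?thesis
    by simp
next
  case False
  with IJK have pos: "I > 0" "J > 0" "K > 0"
    by auto
  define C where "C = I powr a * J powr b * K powr c"
  have "C > 0"
    using pos by (simp add: C_def)
  have pointwise: "F x powr a * G x powr b * H x powr c
      \<le> C * (a / I) * F x + C * (b / J) * G x + C * (c / K) * H x" for x
  proof -
    have "F x powr a * G x powr b * H x powr c
        = C * ((F x / I) powr a * (G x / J) powr b * (H x / K) powr c)"
      using pos nonneg by (simp add: C_def powr_divide)
    also have "\<dots> \<le> C * (a * (F x / I) + b * (G x / J) + c * (H x / K))"
      using pos nonneg w \<open>C > 0\<close> by (intro mult_left_mono weighted_arith_geo_mean3) auto
    also have "\<dots> = C * (a / I) * F x + C * (b / J) * G x + C * (c / K) * H x"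
      by (simp add: algebra_simps)
    finally show ?thesis .
  qed
  have coeff: "C * (a / I) \<ge> 0" "C * (b / J) \<ge> 0" "C * (c / K) \<ge> 0"
    using pos w \<open>C > 0\<close> by auto
  have "(\<integral>\<^sup>+x. ennreal (F x powr a * G x powr b * H x powr c) \<partial>M)
      \<le> (\<integral>\<^sup>+x. ennreal (C * (a / I)) * ennreal (F x) + ennreal (C * (b / J)) * ennreal (G x)
          + ennreal (C * (c / K)) * ennreal (H x) \<partial>M)"
  proof (intro nn_integral_mono)
    fix x
    have "ennreal (F x powr a * G x powr b * H x powr c)
        \<le> ennreal (C * (a / I) * F x + C * (b / J) * G x + C * (c / K) * H x)"
      by (intro ennreal_leI pointwise)
    also have "\<dots> = ennreal (C * (a / I)) * ennreal (F x) + ennreal (C * (b / J)) * ennreal (G x)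
          + ennreal (C * (c / K)) * ennreal (H x)"
      using coeff nonneg by (simp add: ennreal_plus ennreal_mult del: times_divide_eq_right)
    finally show "ennreal (F x powr a * G x powr b * H x powr c) \<le> \<dots>" .
  qed
  also have "\<dots> = ennreal (C * (a / I)) * (\<integral>\<^sup>+x. ennreal (F x) \<partial>M)
      + ennreal (C * (b / J)) * (\<integral>\<^sup>+x. ennreal (G x) \<partial>M)
      + ennreal (C * (c / K)) * (\<integral>\<^sup>+x. ennreal (H x) \<partial>M)"
    by (simp add: nn_integral_add nn_integral_cmult)
  also have "\<dots> \<le> ennreal (C * (a / I)) * ennreal I + ennreal (C * (b / J)) * ennreal J
      + ennreal (C * (c / K)) * ennreal K"
    by (intro add_mono mult_left_mono bounds) auto
  also have "\<dots> = ennreal (C * (a / I) * I + C * (b / J) * J + C * (c / K) * K)"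
    using coeff IJK by (simp add: ennreal_plus ennreal_mult del: times_divide_eq_right times_divide_eq_left)
  also have "C * (a / I) * I + C * (b / J) * J + C * (c / K) * K = C * (a + b + c)"
    using pos by (simp add: field_simps)
  finally show ?thesis
    using w(4) by (simp add: C_def)
qed


section \<open>Young's inequality for integral operators\<close>

text \<open>The quantity \<open>I\<close> in the proof collects the part of \<open>|f k|\<close> that depends jointly on both variables.
  Its total integral is at most \<open>P Q\<close> by Tonelli's theorem and the column bound, which gives both the
  almost everywhere existence of the operator and, after raising Hoelder's bound to the power \<open>r\<close>, its norm.\<close>

lemma Young_integral_operator:
  fixes k :: "'a \<Rightarrow> 'b \<Rightarrow> complex" and f :: "'b \<Rightarrow> complex" and p q r B :: real
  assumes "sigma_finite_measure M" "sigma_finite_measure N"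
    and k[measurable]: "case_prod k \<in> borel_measurable (M \<Otimes>\<^sub>M N)"
    and "p \<ge> 1" "q \<ge> 1" "r > 0" and pqr: "1 + 1 / r = 1 / p + 1 / q"
    and f: "f \<in> Lp_space p N" and "B \<ge> 0"
    and rows: "\<And>x. x \<in> space M \<Longrightarrow> (\<integral>\<^sup>+y. ennreal (norm (k x y) powr q) \<partial>N) \<le> ennreal (B powr q)"
    and columns: "\<And>y. y \<in> space N \<Longrightarrow> (\<integral>\<^sup>+x. ennreal (norm (k x y) powr q) \<partial>M) \<le> ennreal (B powr q)"
  defines "T \<equiv> (\<lambda>x. LINT y|N. f y * k x y)"
  shows "AE x in M. integrable N (\<lambda>y. f y * k x y)"
    and "T \<in> Lp_space r M"
    and "Lp_norm r M T \<le> Lp_norm p N f * B"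
proof -
  interpret M: sigma_finite_measure M by fact
  interpret N: sigma_finite_measure N by fact
  interpret pair_sigma_finite M N ..
  have [measurable]: "f \<in> borel_measurable N" and f_int: "integrable N (\<lambda>y. norm (f y) powr p)"
    using f by (auto simp: Lp_space_def)
  have [measurable]: "T \<in> borel_measurable M"
    unfolding T_def by measurable
  define P where "P = (LINT y|N. norm (f y) powr p)"
  define Q where "Q = B powr q"
  have "P \<ge> 0" "Q \<ge> 0"
    by (auto simp: P_def Q_def)
  have nn_P: "(\<integral>\<^sup>+y. ennreal (norm (f y) powr p) \<partial>N) = ennreal P"
    using f_int by (simp add: P_def nn_integral_eq_integral)
  define I where "I = (\<lambda>x. \<integral>\<^sup>+y. ennreal (norm (f y) powr p * norm (k x y) powr q) \<partial>N)"
  have [measurable]: "I \<in> borel_measurable M"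
    unfolding I_def by measurable
  have int_I: "(\<integral>\<^sup>+x. I x \<partial>M) \<le> ennreal (P * Q)"
  proof -
    have "(\<integral>\<^sup>+x. I x \<partial>M)
        = (\<integral>\<^sup>+y. (\<integral>\<^sup>+x. ennreal (norm (f y) powr p * norm (k x y) powr q) \<partial>M) \<partial>N)"
      unfolding I_def by (rule Fubini'[symmetric]) measurable
    also have "\<dots> = (\<integral>\<^sup>+y. ennreal (norm (f y) powr p)
        * (\<integral>\<^sup>+x. ennreal (norm (k x y) powr q) \<partial>M) \<partial>N)"
      by (intro nn_integral_cong) (simp add: ennreal_mult nn_integral_cmult)
    also have "\<dots> \<le> (\<integral>\<^sup>+y. ennreal (norm (f y) powr p) * ennreal Q \<partial>N)"
      unfolding Q_def by (intro nn_integral_mono mult_left_mono columns) auto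
    also have "\<dots> = ennreal (P * Q)"
      using \<open>P \<ge> 0\<close> \<open>Q \<ge> 0\<close> by (simp add: nn_integral_multc nn_P ennreal_mult)
    finally show ?thesis .
  qed
  define D where "D = P powr (1 - 1 / q) * Q powr (1 - 1 / p)"
  have "D \<ge> 0"
    by (simp add: D_def)
  have kernel_bound: "(\<integral>\<^sup>+y. ennreal (norm (f y * k x y)) \<partial>N) \<le> ennreal (enn2real (I x) powr (1 / r) * D)"
    if x: "x \<in> space M" and fin: "I x < \<infinity>" for x
  proof -
    have split_f: "s = (s powr p) powr (1 / r) * (s powr p) powr (1 - 1 / q)" if "s \<ge> 0" for s :: real
    proof -
      have "p * (1 / r) + p * (1 - 1 / q) = p * (1 + 1 / r - 1 / q)"
        by (simp add: algebra_simps)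
      also have "\<dots> = 1"
        using pqr \<open>p \<ge> 1\<close> by simp
      finally show ?thesis
        using that by (simp add: powr_powr flip: powr_add)
    qed
    have split_k: "s = (s powr q) powr (1 / r) * (s powr q) powr (1 - 1 / p)" if "s \<ge> 0" for s :: real
    proof -
      have "q * (1 / r) + q * (1 - 1 / p) = q * (1 + 1 / r - 1 / p)"
        by (simp add: algebra_simps)
      also have "\<dots> = 1"
        using pqr \<open>q \<ge> 1\<close> by simp
      finally show ?thesis
        using that by (simp add: powr_powr flip: powr_add)
    qed
    have "norm (f y * k x y) = (norm (f y) powr p * norm (k x y) powr q) powr (1 / r)
        * (norm (f y) powr p) powr (1 - 1 / q) * (norm (k x y) powr q) powr (1 - 1 / p)" for y
    proof -
      have "norm (f y * k x y)
          = ((norm (f y) powr p) powr (1 / r) * (norm (f y) powr p) powr (1 - 1 / q))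
          * ((norm (k x y) powr q) powr (1 / r) * (norm (k x y) powr q) powr (1 - 1 / p))"
        using split_f[of "norm (f y)"] split_k[of "norm (k x y)"] by (simp add: norm_mult)
      then show ?thesis
        by (simp add: powr_mult algebra_simps)
    qed
    then have "(\<integral>\<^sup>+y. ennreal (norm (f y * k x y)) \<partial>N)
        = (\<integral>\<^sup>+y. ennreal ((norm (f y) powr p * norm (k x y) powr q) powr (1 / r)
          * (norm (f y) powr p) powr (1 - 1 / q) * (norm (k x y) powr q) powr (1 - 1 / p)) \<partial>N)"
      by simp
    also have "\<dots> \<le> ennreal (enn2real (I x) powr (1 / r) * P powr (1 - 1 / q) * Q powr (1 - 1 / p))"
    proof (rule Holder3_nn_integral)
      show "(\<integral>\<^sup>+y. ennreal (norm (f y) powr p * norm (k x y) powr q) \<partial>N) \<le> ennreal (enn2real (I x))"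
        using fin by (simp add: I_def)
      show "(\<integral>\<^sup>+y. ennreal (norm (k x y) powr q) \<partial>N) \<le> ennreal Q"
        using rows[OF x] by (simp add: Q_def)
      show "1 / r + (1 - 1 / q) + (1 - 1 / p) = 1"
        using pqr by simp
    qed (use x \<open>p \<ge> 1\<close> \<open>q \<ge> 1\<close> \<open>r > 0\<close> \<open>P \<ge> 0\<close> \<open>Q \<ge> 0\<close> in \<open>auto simp: nn_P\<close>)
    finally show ?thesis
      by (simp add: D_def mult.assoc)
  qed
  have I_fin: "AE x in M. I x < \<infinity>"
  proof -
    have "(\<integral>\<^sup>+x. I x \<partial>M) \<noteq> \<infinity>"
      using int_I by (auto simp: top_unique)
    then show ?thesis
      using nn_integral_PInf_AE[of I M] by (simp add: less_top)
  qed
  show "AE x in M. integrable N (\<lambda>y. f y * k x y)"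
    using I_fin AE_space
  proof eventually_elim
    case (elim x)
    then show ?case
      using kernel_bound[of x] by (intro integrableI_bounded) (auto intro: le_less_trans)
  qed
  have T_bound: "AE x in M. ennreal (norm (T x) powr r) \<le> ennreal (D powr r) * I x"
    using I_fin AE_space
  proof eventually_elim
    case (elim x)
    have "ennreal (norm (T x)) \<le> (\<integral>\<^sup>+y. ennreal (norm (f y * k x y)) \<partial>N)"
      \<comment> \<open>The integral is zero by convention where it does not exist.\<close>
    proof (cases "integrable N (\<lambda>y. f y * k x y)")
      case True
      then show ?thesis
        unfolding T_def by (rule integral_norm_bound_ennreal)
    next
      case False
      then show ?thesis
        unfolding T_def by (simp add: not_integrable_integral_eq)
    qed
    also have "\<dots> \<le> ennreal (enn2real (I x) powr (1 / r) * D)"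
      using elim by (intro kernel_bound) auto
    finally have "norm (T x) \<le> enn2real (I x) powr (1 / r) * D"
      using \<open>D \<ge> 0\<close> by (simp add: ennreal_le_iff)
    then have "norm (T x) powr r \<le> (enn2real (I x) powr (1 / r) * D) powr r"
      using \<open>r > 0\<close> by (intro powr_mono2) auto
    also have "\<dots> = D powr r * enn2real (I x)"
      using \<open>r > 0\<close> \<open>D \<ge> 0\<close> by (simp add: powr_mult powr_powr mult.commute)
    finally have "ennreal (norm (T x) powr r) \<le> ennreal (D powr r * enn2real (I x))"
      by (rule ennreal_leI)
    also have "\<dots> = ennreal (D powr r) * I x"
      using elim by (simp add: ennreal_mult)
    finally show ?case .
  qed
  have int_T: "(\<integral>\<^sup>+x. ennreal (norm (T x) powr r) \<partial>M) \<le> ennreal (D powr r * (P * Q))"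
  proof -
    have "(\<integral>\<^sup>+x. ennreal (norm (T x) powr r) \<partial>M) \<le> (\<integral>\<^sup>+x. ennreal (D powr r) * I x \<partial>M)"
      by (rule nn_integral_mono_AE) (rule T_bound)
    also have "\<dots> = ennreal (D powr r) * (\<integral>\<^sup>+x. I x \<partial>M)"
      by (rule nn_integral_cmult) measurable
    also have "\<dots> \<le> ennreal (D powr r) * ennreal (P * Q)"
      by (intro mult_left_mono int_I) auto
    also have "\<dots> = ennreal (D powr r * (P * Q))"
      using \<open>P \<ge> 0\<close> \<open>Q \<ge> 0\<close> by (simp add: ennreal_mult)
    finally show ?thesis .
  qed
  have T_int: "integrable M (\<lambda>x. norm (T x) powr r)"
    using int_T by (intro integrableI_bounded) (auto intro: le_less_trans)
  then show "T \<in> Lp_space r M"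
    by (simp add: Lp_space_def)
  have "ennreal (LINT x|M. norm (T x) powr r) \<le> ennreal (D powr r * (P * Q))"
    using int_T T_int by (simp add: nn_integral_eq_integral)
  then have "(LINT x|M. norm (T x) powr r) \<le> D powr r * (P * Q)"
    using \<open>P \<ge> 0\<close> \<open>Q \<ge> 0\<close> by (simp add: ennreal_le_iff)
  also have "D powr r * (P * Q) = P powr (r / p) * Q powr (r / q)"
  proof -
    have exps: "(1 - 1 / q) * r + 1 = r / p" "(1 - 1 / p) * r + 1 = r / q"
    proof -
      have "r * (1 + 1 / r) = r * (1 / p + 1 / q)"
        using pqr by simp
      then have "r + 1 = r / p + r / q"
        using \<open>r > 0\<close> by (simp add: distrib_left)
      then show "(1 - 1 / q) * r + 1 = r / p" "(1 - 1 / p) * r + 1 = r / q"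
        by (simp_all add: algebra_simps)
    qed
    have "D powr r * (P * Q) = (P powr ((1 - 1 / q) * r) * P powr 1) * (Q powr ((1 - 1 / p) * r) * Q powr 1)"
      using \<open>P \<ge> 0\<close> \<open>Q \<ge> 0\<close> by (simp add: D_def powr_mult powr_powr)
    then show ?thesis
      by (simp only: exps flip: powr_add)
  qed
  finally have "Lp_norm r M T \<le> (P powr (r / p) * Q powr (r / q)) powr (1 / r)"
    using \<open>r > 0\<close> unfolding Lp_norm_def by (intro powr_mono2) auto
  also have "\<dots> = P powr (1 / p) * B"
    using \<open>r > 0\<close> \<open>q \<ge> 1\<close> \<open>B \<ge> 0\<close> by (simp add: powr_mult powr_powr Q_def)
  finally show "Lp_norm r M T \<le> Lp_norm p N f * B"
    by (simp add: Lp_norm_def P_def)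
qed


section \<open>The volume measure in geodesic coordinates\<close>

context riemannian_manifold
begin

lemma param_inverse:
  assumes "geodesic_coordinates x c"
  shows "snd c (param c z) = z" "param c (snd c y) = y"
    and "continuous_on UNIV (snd c)" "continuous_on UNIV (param c)"
proof -
  have "is_chart c" "fst c = UNIV" "range (snd c) = UNIV"
    using assms charts by (auto simp: geodesic_coordinates_def)
  then have "homeomorphism UNIV UNIV (snd c) (param c)"
    by (simp add: is_chart_def)
  then show "snd c (param c z) = z" "param c (snd c y) = y"
    and "continuous_on UNIV (snd c)" "continuous_on UNIV (param c)"
    by (auto simp: homeomorphism_def)
qed

lemma dist_param:
  assumes "geodesic_coordinates x c"
  shows "dist x (param c z) = norm z"
  using assms param_inverse(1)[OF assms] by (simp add: geodesic_coordinates_def)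

definition volume_density :: "'a set \<times> ('a \<Rightarrow> real^'n) \<Rightarrow> real^'n \<Rightarrow> real" where
  "volume_density c z = sqrt (det (G c (param c z)))"

lemma volume_density_measurable:
  assumes "geodesic_coordinates x c"
  shows "volume_density c \<in> borel_measurable borel"
proof -
  have "smooth_on (\<lambda>z. G c (param c z)) UNIV"
    using G_smooth[of c] assms by (simp add: geodesic_coordinates_def)
  then have "Ck_on 0 (\<lambda>z. G c (param c z)) UNIV"
    unfolding smooth_on_def by blast
  then have "continuous_on UNIV (\<lambda>z. G c (param c z))"
    by simp
  then have "continuous_on UNIV (volume_density c)"
    unfolding volume_density_def det_def by (intro continuous_intros)
  then show ?thesis
    by (rule borel_measurable_continuous_onI)
qed

text \<open>Geodesic coordinates are global, so the local formula for the volume in one chart already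
  determines the measure.\<close>

lemma volume_eq_distr_density:
  assumes vol: "is_volume vol" and c: "geodesic_coordinates x c"
  shows "vol = distr (density lborel (\<lambda>z. ennreal (volume_density c z))) borel (param c)"
proof (rule measure_eqI)
  note [measurable] = volume_density_measurable[OF c]
    borel_measurable_continuous_onI[OF param_inverse(4)[OF c]]
  show "sets vol = sets (distr (density lborel (\<lambda>z. ennreal (volume_density c z))) borel (param c))"
    using vol by (simp add: is_volume_def)
  fix S assume "S \<in> sets vol"
  then have [measurable]: "S \<in> sets borel"
    using vol by (simp add: is_volume_def)
  have image: "snd c ` S = param c -` S"
    by (auto simp: param_inverse[OF c] intro!: image_eqI[where x = "param c _"])
  have "emeasure vol S = (\<integral>\<^sup>+z\<in>snd c ` S. ennreal (volume_density c z) \<partial>lborel)"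
    using vol c by (auto simp: is_volume_def geodesic_coordinates_def volume_density_def)
  also have "\<dots> = emeasure (distr (density lborel (\<lambda>z. ennreal (volume_density c z))) borel (param c)) S"
    using measurable_sets_borel[of "param c" borel S]
    by (simp add: image emeasure_distr emeasure_density)
  finally show "emeasure vol S = \<dots>" .
qed

text \<open>Read in a global chart, the volume has a finite-valued density with respect to Lebesgue measure,
  and \<sigma>-finiteness pulls back along the chart.\<close>

lemma sigma_finite_volume:
  assumes vol: "is_volume vol" and c: "geodesic_coordinates x c"
  shows "sigma_finite_measure vol"
proof (rule sigma_finite_measure_distr)
  note [measurable] = volume_density_measurable[OF c]
    borel_measurable_continuous_onI[OF param_inverse(4)[OF c]]
    borel_measurable_continuous_onI[OF param_inverse(3)[OF c]]
  let ?D = "density lborel (\<lambda>z. ennreal (volume_density c z))"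
  show "snd c \<in> measurable vol borel"
    using vol by (subst volume_eq_distr_density[OF vol c]) simp
  have "distr vol borel (snd c) = distr ?D borel (snd c \<circ> param c)"
    by (subst volume_eq_distr_density[OF vol c], subst distr_distr) auto
  also have "snd c \<circ> param c = id"
    using param_inverse(1)[OF c] by auto
  also have "distr ?D borel id = ?D"
    by (rule distr_id2[unfolded id_def[symmetric]]) simp
  finally have eq: "distr vol borel (snd c) = ?D" .
  show "sigma_finite_measure (distr vol borel (snd c))"
    unfolding eq by (subst sigma_finite_measure.sigma_finite_iff_density_finite[OF sigma_finite_lborel]) auto
qed

end

context harmonic_manifold
begin

text \<open>The right-hand side does not mention \<open>x\<close>: integrals of radial functions are independent of the
  centre. It is the polar coordinate formula \<open>\<omega>\<^bsub>n-1\<^esub> \<integral> h(s) A(s) ds\<close> before the angular integration.\<close>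

lemma nn_integral_radial:
  fixes h :: "real \<Rightarrow> ennreal"
  assumes h[measurable]: "h \<in> borel_measurable borel"
  shows "(\<integral>\<^sup>+y. h (dist x y) \<partial>vol)
    = (\<integral>\<^sup>+z. ennreal (A (norm z) / norm z ^ (CARD('n) - 1)) * h (norm (z :: real^'n)) \<partial>lborel)"
proof -
  obtain c where c: "geodesic_coordinates x c"
    using geodesic_coordinates_exist by blast
  note [measurable] = volume_density_measurable[OF c]
    borel_measurable_continuous_onI[OF param_inverse(4)[OF c]]
  have density: "volume_density c z = A (norm z) / norm z ^ (CARD('n) - 1)" if "z \<noteq> 0" for z
  proof -
    have "param c z \<noteq> x"
      using dist_param[OF c, of z] that by auto
    from radial_density[OF c this] show ?thesis
      using that by (simp add: volume_density_def param_inverse[OF c] dist_param[OF c] field_simps)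
  qed
  have "(\<integral>\<^sup>+y. h (dist x y) \<partial>vol)
      = (\<integral>\<^sup>+z. ennreal (volume_density c z) * h (dist x (param c z)) \<partial>lborel)"
    by (subst volume_eq_distr_density[OF volume c]) (simp add: nn_integral_distr nn_integral_density)
  also have "\<dots> = (\<integral>\<^sup>+z. ennreal (A (norm z) / norm z ^ (CARD('n) - 1)) * h (norm (z :: real^'n)) \<partial>lborel)"
  proof (rule nn_integral_cong_AE)
    show "AE z in lborel. ennreal (volume_density c z) * h (dist x (param c z))
        = ennreal (A (norm z) / norm z ^ (CARD('n) - 1)) * h (norm (z :: real^'n))"
      using AE_lborel_singleton[of 0]
      by eventually_elim (simp add: density dist_param[OF c])
  qed
  finally show ?thesis .
qed

text \<open>Along the ray \<open>s \<mapsto> param c (s e)\<close> with a unit vector \<open>e\<close> the distance from \<open>\<sigma>\<close> is \<open>|s|\<close>, so \<open>u |s|\<close> is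
  the composition of the radial function with a continuous curve. The absolute value is essential: the
  radial function carries no information on \<open>u\<close> at negative arguments.\<close>

lemma radial_profile_measurable:
  fixes u :: "real \<Rightarrow> complex" and \<sigma> :: 'a
  assumes "u \<circ> dist \<sigma> \<in> borel_measurable borel"
  shows "(\<lambda>s. u \<bar>s\<bar>) \<in> borel_measurable borel"
proof -
  obtain c where c: "geodesic_coordinates \<sigma> c"
    using geodesic_coordinates_exist by blast
  obtain e :: "real^'n" where e: "norm e = 1"
    using norm_axis_1 by blast
  have "continuous_on UNIV (\<lambda>s::real. param c (s *\<^sub>R e))"
    by (rule continuous_on_compose2[OF param_inverse(4)[OF c]]) (auto intro: continuous_intros)
  then have "(\<lambda>s::real. param c (s *\<^sub>R e)) \<in> borel_measurable borel"
    by (rule borel_measurable_continuous_onI)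
  then have "(\<lambda>s. (u \<circ> dist \<sigma>) (param c (s *\<^sub>R e))) \<in> borel_measurable borel"
    using assms by (rule measurable_compose)
  then show ?thesis
    by (simp add: dist_param[OF c] e)
qed

end


section \<open>Young's inequality for radial convolution\<close>

theorem lemma3p9:
  fixes atlas :: "('a::{metric_space,second_countable_topology} set \<times> ('a \<Rightarrow> real^'n)) set"
    and G :: "'a set \<times> ('a \<Rightarrow> real^'n) \<Rightarrow> 'a \<Rightarrow> real^'n^'n"
    and vol :: "'a measure" and A :: "real \<Rightarrow> real"
    and p q r :: real and \<sigma> :: 'a and f g :: "'a \<Rightarrow> complex" and u :: "real \<Rightarrow> complex"
  assumes "harmonic_manifold atlas G vol A"
    and "simply_connected (UNIV :: 'a set)" and "\<not> compact (UNIV :: 'a set)" and "rank_one A"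
    and "1 \<le> p" and "1 \<le> q" and "0 < r" and "1 + 1 / r = 1 / p + 1 / q"
    and "f \<in> Lp_space p vol" and "g \<in> Lp_space q vol" and "g = u \<circ> dist \<sigma>"
  shows "(AE x in vol. integrable vol (\<lambda>y. f y * translate u x y)) \<and>
    convolution vol f u \<in> Lp_space r vol \<and>
    Lp_norm r vol (convolution vol f u) \<le> Lp_norm p vol f * Lp_norm q vol g"
proof -
  interpret harmonic_manifold atlas G vol A by fact
  have sets_vol[measurable_cong]: "sets vol = sets borel"
    using volume by (simp add: is_volume_def)
  have g_meas: "u \<circ> dist \<sigma> \<in> borel_measurable borel"
    and g_int: "integrable vol (\<lambda>y. norm (g y) powr q)"
    using assms(10,11) by (auto simp: Lp_space_def cong: measurable_cong_sets[OF sets_vol refl])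
  note [measurable] = radial_profile_measurable[OF g_meas]
  define B where "B = Lp_norm q vol g"
  have "B \<ge> 0"
    by (simp add: B_def Lp_norm_def)
  have centre_indep: "(\<integral>\<^sup>+y. ennreal (norm (u (dist x y)) powr q) \<partial>vol) = ennreal (B powr q)" for x
  proof -
    have "(\<integral>\<^sup>+y. ennreal (norm (u (dist x y)) powr q) \<partial>vol)
        = (\<integral>\<^sup>+y. (\<lambda>s. ennreal (norm (u \<bar>s\<bar>) powr q)) (dist x y) \<partial>vol)"
      by simp
    also have "\<dots> = (\<integral>\<^sup>+y. (\<lambda>s. ennreal (norm (u \<bar>s\<bar>) powr q)) (dist \<sigma> y) \<partial>vol)"
      by (subst (1 2) nn_integral_radial) auto
    also have "\<dots> = (\<integral>\<^sup>+y. ennreal (norm (g y) powr q) \<partial>vol)"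
      by (simp add: assms(11))
    also have "\<dots> = ennreal (LINT y|vol. norm (g y) powr q)"
      using g_int by (simp add: nn_integral_eq_integral)
    also have "(LINT y|vol. norm (g y) powr q) = B powr q"
      using \<open>1 \<le> q\<close> by (simp add: B_def Lp_norm_def powr_powr)
    finally show ?thesis .
  qed
  have "(\<lambda>(x, y). u \<bar>dist x y\<bar>) \<in> borel_measurable (vol \<Otimes>\<^sub>M vol)"
    by measurable
  then have kernel: "case_prod (translate u) \<in> borel_measurable (vol \<Otimes>\<^sub>M vol)"
    by (simp add: translate_def case_prod_unfold)
  obtain c where "geodesic_coordinates \<sigma> c"
    using geodesic_coordinates_exist by blast
  then have sigma_finite: "sigma_finite_measure vol"
    by (rule sigma_finite_volume[OF volume])
  have rows: "(\<integral>\<^sup>+y. ennreal (norm (translate u x y) powr q) \<partial>vol) \<le> ennreal (B powr q)" for x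
    by (simp add: translate_def centre_indep)
  have columns: "(\<integral>\<^sup>+x. ennreal (norm (translate u x y) powr q) \<partial>vol) \<le> ennreal (B powr q)" for y
    using centre_indep[of y] by (simp add: translate_def dist_commute)
  have conv: "convolution vol f u = (\<lambda>x. LINT y|vol. f y * translate u x y)"
    by (simp add: fun_eq_iff convolution_def)
  show ?thesis
    unfolding conv B_def[symmetric]
    using Young_integral_operator[OF sigma_finite sigma_finite kernel assms(5-9) \<open>B \<ge> 0\<close> rows columns]
    by blast
qed

end
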